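(* Let $\mathcal{X}$ be a non-empty finite set and $N\geq 1$ an integer. A set $\mathcal{R}\subseteq\mathcal{G}(\mathcal{X}^N)$ of gambles on $\mathcal{X}^N$ is coherent and exchangeable if and only if there is some coherent set $\mathcal{S}\subseteq\mathcal{G}(\mathcal{N}^N)$ of gambles on $\mathcal{N}^N$ such that $$\mathcal{R}=(\mathrm{Hy}^N)^{-1}(\mathcal{S}),$$ and in that case this $\mathcal{S}$ is uniquely determined by $$\mathcal{S}=\{g\in\mathcal{G}(\mathcal{N}^N):\mathrm{Co}^N(g)\in\mathcal{R}\}=\mathrm{Hy}^N(\mathcal{R}).$$
   Context: A gamble on a non-empty set $\Omega$ is a bounded function $\Omega\to\mathbb{R}$; $\mathcal{G}(\Omega)$ is the real linear space of all gambles on $\Omega$. Write $f\geq g$ for the pointwise ordering, and $f>g$ iff $f\geq g$ and $f\neq g$. A set $\mathcal{R}\subseteq\mathcal{G}(\Omega)$ is coherent if: (D1) $0\notin\mathcal{R}$; (D2) $f>0$ implies $f\in\mathcal{R}$; (D3) $f\in\mathcal{R}$ and $\lambda>0$ imply $\lambda f\in\mathcal{R}$; (D4) $f_1,f_2\in\mathcal{R}$ implies $f_1+f_2\in\mathcal{R}$. Let $\mathcal{P}_N$ be the set of permutations $\pi$ of $\{1,\dots,N\}$; put $\pi(x_1,\dots,x_N)=(x_{\pi(1)},\dots,x_{\pi(N)})$ and $\pi^tf=f\circ\pi$ for $f\in\mathcal{G}(\mathcal{X}^N)$. A coherent set $\mathcal{R}\subseteq\mathcal{G}(\mathcal{X}^N)$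 is exchangeable if $h+(f-\pi^tf)\in\mathcal{R}$ for all $h\in\mathcal{R}$, $f\in\mathcal{G}(\mathcal{X}^N)$ and $\pi\in\mathcal{P}_N$. $\mathcal{N}^N=\{m\in\mathbb{Z}_{\geq0}^{\mathcal{X}}:\sum_{z\in\mathcal{X}}m_z=N\}$ is the set of count vectors. The counting map $T^N:\mathcal{X}^N\to\mathcal{N}^N$ has components $T^N_z(x)=|\{k:x_k=z\}|$, $z\in\mathcal{X}$. For $m\in\mathcal{N}^N$, $[m]=\{x\in\mathcal{X}^N:T^N(x)=m\}$. The linear map $\mathrm{Hy}^N:\mathcal{G}(\mathcal{X}^N)\to\mathcal{G}(\mathcal{N}^N)$ is given by $\mathrm{Hy}^N(f)(m)=\frac{1}{|[m]|}\sum_{y\in[m]}f(y)$, and $\mathrm{Co}^N:\mathcal{G}(\mathcal{N}^N)\to\mathcal{G}(\mathcal{X}^N)$ by $\mathrm{Co}^N(g)=g\circ T^N$. *)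

theory Defs
  imports "HOL-Analysis.Analysis" "HOL-Combinatorics.Permutations"
begin

(* Functions on a set \<Omega> are represented by functions that are "undefined" outside
   \<Omega> (as in HOL-Library.FuncSet), so that equality of gambles is equality on \<Omega>.
   Consequently the pointwise operations are formed with restricted abstraction. *)

definition gambles :: "'w set \<Rightarrow> ('w \<Rightarrow> real) set" where
  "gambles \<Omega> = {f \<in> extensional \<Omega>. bounded (f ` \<Omega>)}"

definition gamble_zero :: "'w set \<Rightarrow> 'w \<Rightarrow> real" where
  "gamble_zero \<Omega> = (\<lambda>\<omega>\<in>\<Omega>. 0)"

definition gamble_add :: "'w set \<Rightarrow> ('w \<Rightarrow> real) \<Rightarrow> ('w \<Rightarrow> real) \<Rightarrow> 'w \<Rightarrow> real" where
  "gamble_add \<Omega> f g = (\<lambda>\<omega>\<in>\<Omega>. f \<omega> + g \<omega>)"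

definition gamble_diff :: "'w set \<Rightarrow> ('w \<Rightarrow> real) \<Rightarrow> ('w \<Rightarrow> real) \<Rightarrow> 'w \<Rightarrow> real" where
  "gamble_diff \<Omega> f g = (\<lambda>\<omega>\<in>\<Omega>. f \<omega> - g \<omega>)"

definition gamble_scale :: "'w set \<Rightarrow> real \<Rightarrow> ('w \<Rightarrow> real) \<Rightarrow> 'w \<Rightarrow> real" where
  "gamble_scale \<Omega> c f = (\<lambda>\<omega>\<in>\<Omega>. c * f \<omega>)"

definition gamble_geq :: "'w set \<Rightarrow> ('w \<Rightarrow> real) \<Rightarrow> ('w \<Rightarrow> real) \<Rightarrow> bool" where
  "gamble_geq \<Omega> f g \<longleftrightarrow> (\<forall>\<omega>\<in>\<Omega>. f \<omega> \<ge> g \<omega>)"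

definition gamble_gt :: "'w set \<Rightarrow> ('w \<Rightarrow> real) \<Rightarrow> ('w \<Rightarrow> real) \<Rightarrow> bool" where
  "gamble_gt \<Omega> f g \<longleftrightarrow> gamble_geq \<Omega> f g \<and> f \<noteq> g"

definition coherent_set :: "'w set \<Rightarrow> ('w \<Rightarrow> real) set \<Rightarrow> bool" where
  "coherent_set \<Omega> R \<longleftrightarrow>
     R \<subseteq> gambles \<Omega> \<and>
     gamble_zero \<Omega> \<notin> R \<and>
     (\<forall>f\<in>gambles \<Omega>. gamble_gt \<Omega> f (gamble_zero \<Omega>) \<longrightarrow> f \<in> R) \<and>
     (\<forall>f\<in>R. \<forall>c>0. gamble_scale \<Omega> c f \<in> R) \<and>
     (\<forall>f\<in>R. \<forall>g\<in>R. gamble_add \<Omega> f g \<in> R)"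

definition tuples :: "'a set \<Rightarrow> nat \<Rightarrow> (nat \<Rightarrow> 'a) set" where
  "tuples X N = {1..N} \<rightarrow>\<^sub>E X"

(* A permutation of {1..N} fixes every other number ("permutes"), so x \<circ> p is again
   undefined outside {1..N}. *)
definition perm_tuple :: "(nat \<Rightarrow> nat) \<Rightarrow> (nat \<Rightarrow> 'a) \<Rightarrow> nat \<Rightarrow> 'a" where
  "perm_tuple p x = x \<circ> p"

definition perm_gamble ::
  "'a set \<Rightarrow> nat \<Rightarrow> (nat \<Rightarrow> nat) \<Rightarrow> ((nat \<Rightarrow> 'a) \<Rightarrow> real) \<Rightarrow> (nat \<Rightarrow> 'a) \<Rightarrow> real" where
  "perm_gamble X N p f = (\<lambda>x\<in>tuples X N. f (perm_tuple p x))"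

definition exchangeable :: "'a set \<Rightarrow> nat \<Rightarrow> ((nat \<Rightarrow> 'a) \<Rightarrow> real) set \<Rightarrow> bool" where
  "exchangeable X N R \<longleftrightarrow>
     (\<forall>h\<in>R. \<forall>f\<in>gambles (tuples X N). \<forall>p. p permutes {1..N} \<longrightarrow>
        gamble_add (tuples X N) h (gamble_diff (tuples X N) f (perm_gamble X N p f)) \<in> R)"

definition count_vectors :: "'a set \<Rightarrow> nat \<Rightarrow> ('a \<Rightarrow> nat) set" where
  "count_vectors X N = {m \<in> X \<rightarrow>\<^sub>E UNIV. (\<Sum>z\<in>X. m z) = N}"

definition counting_map :: "'a set \<Rightarrow> nat \<Rightarrow> (nat \<Rightarrow> 'a) \<Rightarrow> 'a \<Rightarrow> nat" where
  "counting_map X N x = (\<lambda>z\<in>X. card {k \<in> {1..N}. x k = z})"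

definition count_class :: "'a set \<Rightarrow> nat \<Rightarrow> ('a \<Rightarrow> nat) \<Rightarrow> (nat \<Rightarrow> 'a) set" where
  "count_class X N m = {x \<in> tuples X N. counting_map X N x = m}"

definition Hy :: "'a set \<Rightarrow> nat \<Rightarrow> ((nat \<Rightarrow> 'a) \<Rightarrow> real) \<Rightarrow> ('a \<Rightarrow> nat) \<Rightarrow> real" where
  "Hy X N f = (\<lambda>m\<in>count_vectors X N.
     1 / real (card (count_class X N m)) * (\<Sum>y\<in>count_class X N m. f y))"

definition Co :: "'a set \<Rightarrow> nat \<Rightarrow> (('a \<Rightarrow> nat) \<Rightarrow> real) \<Rightarrow> (nat \<Rightarrow> 'a) \<Rightarrow> real" where
  "Co X N g = (\<lambda>x\<in>tuples X N. g (counting_map X N x))"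

definition Hy_preimage ::
  "'a set \<Rightarrow> nat \<Rightarrow> (('a \<Rightarrow> nat) \<Rightarrow> real) set \<Rightarrow> ((nat \<Rightarrow> 'a) \<Rightarrow> real) set" where
  "Hy_preimage X N S = {f \<in> gambles (tuples X N). Hy X N f \<in> S}"

end

(* Two tuples have the same counts exactly when they are permutations of each other, so the
   indicators of two such tuples differ by a gamble of the form f - f o pi.  A gamble u with
   Hy u = 0 sums to zero over each count class, hence is a combination of such differences (move
   the mass u(y) from each y to a fixed representative of its class).  Therefore membership in an
   exchangeable coherent set depends only on the image under Hy.  As Hy is linear, strictly
   monotone and has Co as a right inverse, everything else follows. *)

theory Submission
  imports Defs
begin

section \<open>Finiteness, the counting map and count classes\<close>

lemma gambles_finite:
  assumes "finite \<Omega>"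
  shows "gambles \<Omega> = extensional \<Omega>"
  using assms by (auto simp: gambles_def finite_imp_bounded)

lemma gamble_add_in_gambles: "finite \<Omega> \<Longrightarrow> gamble_add \<Omega> f g \<in> gambles \<Omega>"
  by (simp add: gambles_finite gamble_add_def)

lemma gamble_scale_in_gambles: "finite \<Omega> \<Longrightarrow> gamble_scale \<Omega> c f \<in> gambles \<Omega>"
  by (simp add: gambles_finite gamble_scale_def)

lemma finite_tuples: "finite X \<Longrightarrow> finite (tuples X N)"
  unfolding tuples_def by (intro finite_PiE) auto

lemma finite_count_class: "finite X \<Longrightarrow> finite (count_class X N m)"
  by (simp add: count_class_def finite_tuples)

lemma counting_map_in_count_vectors:
  assumes "finite X" and "x \<in> tuples X N"
  shows "counting_map X N x \<in> count_vectors X N"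
proof -
  have "x \<in> {1..N} \<rightarrow> X"
    using assms(2) by (auto simp: tuples_def)
  \<comment> \<open>The fibres of \<open>x\<close> over \<open>X\<close> partition
    \<open>{1..N}\<close>; \<open>sum.group\<close> with constant summand 1 adds up their
    sizes.\<close>
  then have "(\<Sum>z\<in>X. card {k \<in> {1..N}. x k = z}) = N"
    using sum.group[of "{1..N}" X x "\<lambda>_. 1::nat"] assms(1) by (simp add: image_subset_iff_funcset)
  then show ?thesis
    by (auto simp: count_vectors_def counting_map_def)
qed

text \<open>Listing the multiset that contains each \<open>z\<close> exactly \<open>m z\<close>
  times gives a tuple with counts \<open>m\<close>. This keeps the denominator in \<open>Hy\<close>
  nonzero and makes the counting map surjective.\<close>

lemma count_class_nonempty:
  assumes "finite X" and "m \<in> count_vectors X N"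
  shows "count_class X N m \<noteq> {}"
proof -
  have m: "m \<in> extensional X" "sum m X = N"
    using assms(2) by (auto simp: count_vectors_def PiE_def)
  define M where "M = (\<Sum>z\<in>X. replicate_mset (m z) z)"
  obtain xs where xs: "mset xs = M"
    using ex_mset by blast
  have count_M: "count M z = (if z \<in> X then m z else 0)" for z
    using assms(1) by (simp add: M_def count_sum)
  have len: "length xs = N"
    using m(2) size_mset[of xs] by (simp add: xs M_def)
  have setxs: "set xs \<subseteq> X"
    using count_M unfolding set_mset_mset[symmetric] xs by (auto simp: set_mset_def split: if_splits)
  \<comment> \<open>List positions start at 0 and tuple indices at 1, hence the shift here and the
    \<open>Suc\<close> below.\<close>
  define x where "x = (\<lambda>k\<in>{1..N}. xs ! (k - 1))"
  have "x \<in> tuples X N"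
    using subsetD[OF setxs nth_mem] by (auto simp: x_def tuples_def len)
  moreover have "counting_map X N x = m"
  proof
    fix z
    have "{k \<in> {1..N}. x k = z} = Suc ` {i. i < length xs \<and> xs ! i = z}"
    proof (intro equalityI subsetI)
      fix k assume "k \<in> {k \<in> {1..N}. x k = z}"
      then show "k \<in> Suc ` {i. i < length xs \<and> xs ! i = z}"
        by (cases k) (auto simp: x_def len)
    qed (auto simp: x_def len)
    then have "card {k \<in> {1..N}. x k = z} = count (mset xs) z"
      by (simp add: card_image count_mset count_list_eq_length_filter length_filter_conv_card
          eq_commute[of z])
    then show "counting_map X N x z = m z"
      using m(1) by (auto simp: counting_map_def xs count_M extensional_def)
  qed
  ultimately show ?thesis
    by (auto simp: count_class_def)
qed

section \<open>Permutations of tuples and their counts\<close>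

lemma perm_tuple_in_tuples:
  assumes "p permutes {1..N}"
  shows "perm_tuple p x \<in> tuples X N \<longleftrightarrow> x \<in> tuples X N"
proof -
  have "perm_tuple q y \<in> tuples X N" if "q permutes {1..N}" "y \<in> tuples X N" for q y
    using that permutes_in_image[OF that(1)] permutes_not_in[OF that(1)]
    by (fastforce simp: perm_tuple_def tuples_def PiE_iff extensional_def)
  from this[of p x] this[of "inv p" "perm_tuple p x"] show ?thesis
    using assms permutes_inv[OF assms] permutes_inv_o(1)[OF assms]
    by (auto simp: perm_tuple_def comp_assoc)
qed

lemma counting_map_perm_tuple:
  assumes "p permutes {1..N}"
  shows "counting_map X N (perm_tuple p x) = counting_map X N x"
proof -
  have "card {k \<in> {1..N}. x (p k) = z} = card {k \<in> {1..N}. x k = z}" for z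
  proof -
    have "{k \<in> {1..N}. x (p k) = z} = p -` {k \<in> {1..N}. x k = z}"
      using permutes_in_image[OF assms] by blast
    then show ?thesis
      by (simp only: card_vimage_inj[OF permutes_inj[OF assms]] permutes_surj[OF assms] subset_UNIV)
  qed
  then show ?thesis
    by (simp add: counting_map_def perm_tuple_def)
qed

text \<open>Equal counts mean equal multisets of entries, and two families over one finite index set
  with equal multisets differ by a permutation of the indices.\<close>

lemma counting_map_eq_imp_perm_tuple:
  assumes "x \<in> tuples X N" "y \<in> tuples X N" "counting_map X N x = counting_map X N y"
  obtains p where "p permutes {1..N}" "x = perm_tuple p y"
proof -
  have "image_mset x (mset_set {1..N}) = image_mset y (mset_set {1..N})"
  proof (rule multiset_eqI)
    fix z
    have count: "count (image_mset w (mset_set {1..N})) z = card {k \<in> {1..N}. w k = z}"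
      for w :: "nat \<Rightarrow> 'a"
      by (simp add: count_image_mset vimage_def Int_def conj_commute)
    show "count (image_mset x (mset_set {1..N})) z = count (image_mset y (mset_set {1..N})) z"
    proof (cases "z \<in> X")
      case True
      then show ?thesis
        using fun_cong[OF assms(3), of z] unfolding count by (simp add: counting_map_def)
    next
      \<comment> \<open>\<open>counting_map\<close> says nothing about values outside
        \<open>X\<close>, but neither tuple takes such a value.\<close>
      case False
      then have "{k \<in> {1..N}. x k = z} = {}" "{k \<in> {1..N}. y k = z} = {}"
        using assms(1,2) by (auto simp: tuples_def)
      then show ?thesis
        unfolding count by (simp only:)
    qed
  qed
  then obtain p where p: "p permutes {1..N}" "\<forall>k\<in>{1..N}. x k = y (p k)"
    using image_mset_eq_implies_permutes[of "{1..N}" x y] by auto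
  \<comment> \<open>For an index outside \<open>{1..N}\<close>, \<open>p\<close> fixes
    \<open>k\<close> and both tuples are \<open>undefined\<close> there.\<close>
  have "x k = y (p k)" for k
    using p assms(1,2) permutes_not_in[OF p(1), of k]
    by (cases "k \<in> {1..N}") (auto simp: tuples_def PiE_iff extensional_def)
  then show thesis
    using that[OF p(1)] by (simp add: perm_tuple_def fun_eq_iff)
qed

text \<open>Used to reindex sums over a count class, so that a gamble and its permuted version have
  the same image under \<open>Hy\<close>.\<close>

lemma bij_betw_perm_tuple_count_class:
  assumes "p permutes {1..N}"
  shows "bij_betw (perm_tuple p) (count_class X N m) (count_class X N m)"
proof (rule bij_betw_byWitness[of _ "perm_tuple (inv p)"])
  show "perm_tuple p ` count_class X N m \<subseteq> count_class X N m"
    "perm_tuple (inv p) ` count_class X N m \<subseteq> count_class X N m"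
    using assms permutes_inv[OF assms]
    by (auto simp: count_class_def perm_tuple_in_tuples counting_map_perm_tuple)
qed (simp_all add: perm_tuple_def comp_assoc permutes_inv_o[OF assms])

section \<open>Linearity and strict monotonicity of Hy, with Co as right inverse\<close>

lemma Hy_eq_iff:
  assumes "finite X"
  shows "Hy X N f = Hy X N g \<longleftrightarrow>
    (\<forall>m\<in>count_vectors X N. sum f (count_class X N m) = sum g (count_class X N m))"
    (is "?L \<longleftrightarrow> ?R")
proof
  assume ?L
  show ?R
  proof
    fix m assume m: "m \<in> count_vectors X N"
    then have "card (count_class X N m) \<noteq> 0"
      using assms by (simp add: count_class_nonempty finite_count_class)
    then show "sum f (count_class X N m) = sum g (count_class X N m)"
      using fun_cong[OF \<open>?L\<close>, of m] m by (simp add: Hy_def)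
  qed
qed (auto simp: Hy_def)

lemma finite_count_vectors:
  assumes "finite X"
  shows "finite (count_vectors X N)"
proof (rule finite_subset)
  show "count_vectors X N \<subseteq> counting_map X N ` tuples X N"
    using count_class_nonempty[OF assms] by (fastforce simp: count_class_def)
qed (simp add: assms finite_tuples)

lemma Co_in_gambles:
  assumes "finite X"
  shows "Co X N g \<in> gambles (tuples X N)"
  by (simp add: gambles_finite finite_tuples assms Co_def)

lemma Hy_in_gambles:
  assumes "finite X"
  shows "Hy X N f \<in> gambles (count_vectors X N)"
  by (simp add: gambles_finite finite_count_vectors assms Hy_def)

text \<open>\<open>Co X N g\<close> is constant on each count class, so averaging returns the
  constant.\<close>

lemma Hy_Co:
  assumes "finite X" "g \<in> gambles (count_vectors X N)"
  shows "Hy X N (Co X N g) = g"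
proof
  fix m
  show "Hy X N (Co X N g) m = g m"
  proof (cases "m \<in> count_vectors X N")
    case True
    then have "card (count_class X N m) \<noteq> 0"
      using assms(1) by (simp add: count_class_nonempty finite_count_class)
    moreover have "sum (Co X N g) (count_class X N m) = card (count_class X N m) * g m"
      by (subst sum_constant[symmetric], rule sum.cong) (auto simp: Co_def count_class_def)
    ultimately show ?thesis
      using True by (simp add: Hy_def)
  next
    case False
    then show ?thesis
      using assms by (auto simp: Hy_def gambles_def extensional_def)
  qed
qed

text \<open>A count class lies inside \<open>tuples X N\<close>, so the restricted abstraction in
  the pointwise operations disappears under the sum.\<close>

lemma sum_count_class_restrict:
  "(\<Sum>y\<in>count_class X N m. (\<lambda>x\<in>tuples X N. f x) y) = (\<Sum>y\<in>count_class X N m. f y)"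
  by (intro sum.cong) (auto simp: count_class_def)

lemma Hy_zero: "Hy X N (gamble_zero (tuples X N)) = gamble_zero (count_vectors X N)"
  unfolding Hy_def gamble_zero_def sum_count_class_restrict by simp

lemma Hy_add:
  "Hy X N (gamble_add (tuples X N) f g) = gamble_add (count_vectors X N) (Hy X N f) (Hy X N g)"
  unfolding Hy_def gamble_add_def sum_count_class_restrict
  by (auto simp: sum.distrib add_divide_distrib)

lemma Hy_scale:
  "Hy X N (gamble_scale (tuples X N) c f) = gamble_scale (count_vectors X N) c (Hy X N f)"
  unfolding Hy_def gamble_scale_def sum_count_class_restrict
  by (auto simp: sum_distrib_left[symmetric])

lemma Hy_add_diff_perm_gamble:
  assumes "p permutes {1..N}"
  shows "Hy X N (gamble_add (tuples X N) h
    (gamble_diff (tuples X N) f (perm_gamble X N p f))) = Hy X N h"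
proof -
  have "(\<Sum>y\<in>count_class X N m. f (perm_tuple p y)) = sum f (count_class X N m)" for m
    by (rule sum.reindex_bij_betw[OF bij_betw_perm_tuple_count_class[OF assms]])
  moreover have "(\<Sum>y\<in>count_class X N m. gamble_add (tuples X N) h
      (gamble_diff (tuples X N) f (perm_gamble X N p f)) y) =
    (\<Sum>y\<in>count_class X N m. h y + (f y - f (perm_tuple p y)))" for m
    by (rule sum.cong) (auto simp: count_class_def gamble_add_def gamble_diff_def perm_gamble_def)
  ultimately show ?thesis
    unfolding Hy_def by (simp add: sum.distrib sum_subtractf)
qed

text \<open>A nonnegative gamble that is positive at some tuple has a positive sum over the class of
  that tuple, so strictness survives averaging.\<close>

lemma Hy_gt_zero:
  assumes "finite X" "f \<in> gambles (tuples X N)"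
    and "gamble_gt (tuples X N) f (gamble_zero (tuples X N))"
  shows "gamble_gt (count_vectors X N) (Hy X N f) (gamble_zero (count_vectors X N))"
proof -
  have nonneg: "f x \<ge> 0" if "x \<in> tuples X N" for x
    using assms(3) that by (auto simp: gamble_gt_def gamble_geq_def gamble_zero_def)
  obtain x where "f x \<noteq> gamble_zero (tuples X N) x"
    using assms(3) by (auto simp: gamble_gt_def)
  \<comment> \<open>Outside \<open>tuples X N\<close> both functions are \<open>undefined\<close>,
    so the point where they differ is a tuple.\<close>
  then have x: "x \<in> tuples X N" "f x > 0"
    using assms(2) nonneg[of x]
    by (auto simp: gamble_zero_def gambles_def extensional_def less_le split: if_splits)
  let ?C = "count_class X N (counting_map X N x)"
  have "x \<in> ?C"
    using x by (simp add: count_class_def)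
  then have "sum f ?C > 0"
    using x nonneg
    by (intro sum_pos2[OF finite_count_class[OF assms(1)]]) (auto simp: count_class_def)
  moreover have "sum (gamble_zero (tuples X N)) ?C = 0"
    by (rule sum.neutral) (auto simp: gamble_zero_def count_class_def)
  ultimately have "Hy X N f \<noteq> gamble_zero (count_vectors X N)"
    using counting_map_in_count_vectors[OF assms(1) x(1)]
    unfolding Hy_zero[symmetric] Hy_eq_iff[OF assms(1)] by fastforce
  moreover have "Hy X N f m \<ge> 0" if "m \<in> count_vectors X N" for m
    using that nonneg by (auto simp: Hy_def count_class_def intro!: divide_nonneg_nonneg sum_nonneg)
  ultimately show ?thesis
    by (simp add: gamble_gt_def gamble_geq_def gamble_zero_def)
qed

lemma Co_gt_zero:
  assumes "finite X" "g \<in> gambles (count_vectors X N)"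
    and "gamble_gt (count_vectors X N) g (gamble_zero (count_vectors X N))"
  shows "gamble_gt (tuples X N) (Co X N g) (gamble_zero (tuples X N))"
proof -
  \<comment> \<open>If \<open>Co X N g\<close> were zero, applying \<open>Hy\<close> would make
    \<open>g\<close> zero.\<close>
  have "Co X N g \<noteq> gamble_zero (tuples X N)"
    using assms(3) Hy_Co[OF assms(1,2)] Hy_zero[of X N] by (auto simp: gamble_gt_def)
  then show ?thesis
    using assms(3) counting_map_in_count_vectors[OF assms(1)]
    by (auto simp: gamble_gt_def gamble_geq_def gamble_zero_def Co_def)
qed

section \<open>Exchangeable sets as unions of fibres of Hy\<close>

lemma exchangeable_cong_Hy:
  assumes "finite X" "R \<subseteq> gambles (tuples X N)" "exchangeable X N R"
    and "h \<in> R" "h' \<in> gambles (tuples X N)" "Hy X N h' = Hy X N h"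
  shows "h' \<in> R"
proof -
  let ?T = "tuples X N"
  have fin: "finite ?T"
    using assms(1) by (rule finite_tuples)
  have ext: "h \<in> extensional ?T" "h' \<in> extensional ?T"
    using assms(2,4,5) by (auto simp: gambles_def)
  define u where "u = (\<lambda>x. h' x - h x)"
  \<comment> \<open>The choice depends on \<open>y\<close> only through its counts, so
    \<open>r\<close> selects one representative per count class.\<close>
  define r where "r = (\<lambda>y. SOME x. x \<in> count_class X N (counting_map X N y))"
  have r: "r y \<in> ?T \<and> counting_map X N (r y) = counting_map X N y" if "y \<in> ?T" for y
    using someI[of "\<lambda>x. x \<in> count_class X N (counting_map X N y)" y] that
    by (simp add: r_def count_class_def)
  have r_cong: "r y = r x" if "counting_map X N y = counting_map X N x" for x y
    using that by (simp add: r_def)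
  \<comment> \<open>Each summand puts the mass \<open>u y\<close> on \<open>y\<close> and takes it
    off \<open>r y\<close>. Exchangeability allows one such transfer at a time, hence the induction
    on the set \<open>F\<close> of tuples already treated.\<close>
  have move: "(\<lambda>x\<in>?T. h x + (\<Sum>y\<in>F. u y * (of_bool (x = y) - of_bool (x = r y)))) \<in> R"
    if "F \<subseteq> ?T" for F
    using finite_subset[OF that fin] that
  proof (induction F rule: finite_induct)
    case empty
    have "(\<lambda>x\<in>?T. h x) = h"
      using ext(1) by (rule extensional_restrict)
    then show ?case
      using assms(4) by simp
  next
    case (insert y F)
    then have y: "y \<in> ?T"
      by simp
    obtain p where p: "p permutes {1..N}" "y = perm_tuple p (r y)"
      using counting_map_eq_imp_perm_tuple[of y X N "r y"] r[OF y] y by metis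
    \<comment> \<open>Permuting this multiple of the indicator of \<open>y\<close> by
      \<open>p\<close> gives the same multiple of the indicator of \<open>r y\<close>; the
      difference of the two is the next summand.\<close>
    define f where "f = (\<lambda>x\<in>?T. u y * of_bool (x = y))"
    have inj: "perm_tuple p x = y \<longleftrightarrow> x = r y" for x
      using p permutes_surj[OF p(1)] unfolding perm_tuple_def
      by (metis comp_assoc comp_id permutes_inv_o(1))
    have f_at: "f x = u y * of_bool (x = y)"
      and f_perm: "f (perm_tuple p x) = u y * of_bool (x = r y)" if "x \<in> ?T" for x
      using that by (simp_all add: f_def perm_tuple_in_tuples[OF p(1)] inj)
    have "f \<in> gambles ?T"
      by (simp add: gambles_finite[OF fin] f_def)
    then have "gamble_add ?T (\<lambda>x\<in>?T. h x + (\<Sum>y\<in>F. u y * (of_bool (x = y) - of_bool (x = r y))))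
        (gamble_diff ?T f (perm_gamble X N p f)) \<in> R"
      using insert assms(3) p(1) unfolding exchangeable_def by blast
    also have "gamble_add ?T (\<lambda>x\<in>?T. h x + (\<Sum>y\<in>F. u y * (of_bool (x = y) - of_bool (x = r y))))
        (gamble_diff ?T f (perm_gamble X N p f)) =
      (\<lambda>x\<in>?T. h x + (\<Sum>y\<in>insert y F. u y * (of_bool (x = y) - of_bool (x = r y))))"
      unfolding gamble_add_def gamble_diff_def perm_gamble_def
      using insert(1,2) by (intro restrict_ext) (simp add: f_perm f_at algebra_simps)
    finally show ?case .
  qed
  \<comment> \<open>Mass is taken only off representatives, and there the total is the sum of
    \<open>u\<close> over the class, which vanishes since \<open>h\<close> and \<open>h'\<close>
    agree under \<open>Hy\<close>.\<close>
  have mass: "(\<Sum>y\<in>?T. u y * of_bool (x = r y)) = 0" if "x \<in> ?T" for x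
  proof (cases "r x = x")
    case True
    have "(\<Sum>y\<in>?T. u y * of_bool (x = r y)) = sum u (count_class X N (counting_map X N x))"
    proof (rule sum.mono_neutral_cong_right[OF fin])
      show "u y * of_bool (x = r y) = u y"
        if "y \<in> count_class X N (counting_map X N x)" for y
        using that True r_cong[of y x] by (simp add: count_class_def)
    qed (use r in \<open>auto simp: count_class_def\<close>)
    also have "\<dots> = 0"
      using assms(6) counting_map_in_count_vectors[OF assms(1) that]
      by (simp add: u_def sum_subtractf Hy_eq_iff[OF assms(1)])
    finally show ?thesis .
  next
    case False
    \<comment> \<open>A tuple of the form \<open>r y\<close> has the counts of \<open>y\<close>, so
      it would be its own representative.\<close>
    then have "x \<noteq> r y" if "y \<in> ?T" for y
      using r[OF that] r_cong[of x y] by auto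
    then show ?thesis
      by (intro sum.neutral) auto
  qed
  have "(\<Sum>y\<in>?T. u y * of_bool (x = y)) = u x" if "x \<in> ?T" for x
    using fin that by (simp add: of_bool_def if_distrib cong: if_cong)
  then have "(\<lambda>x\<in>?T. h x + (\<Sum>y\<in>?T. u y * (of_bool (x = y) - of_bool (x = r y)))) =
      (\<lambda>x\<in>?T. h' x)"
    using mass by (auto simp: right_diff_distrib sum_subtractf u_def)
  also have "\<dots> = h'"
    using ext(2) by (rule extensional_restrict)
  finally show ?thesis
    using move[of ?T] by simp
qed

section \<open>Transfer of coherence and exchangeability along Hy\<close>

lemma coherent_set_Hy_image:
  assumes "finite X" "coherent_set (tuples X N) R" "exchangeable X N R"
  shows "coherent_set (count_vectors X N) (Hy X N ` R)"
proof -
  have R: "R \<subseteq> gambles (tuples X N)" "gamble_zero (tuples X N) \<notin> R"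
    and pos: "\<And>f. f \<in> gambles (tuples X N) \<Longrightarrow>
      gamble_gt (tuples X N) f (gamble_zero (tuples X N)) \<Longrightarrow> f \<in> R"
    and scale: "\<And>f c. f \<in> R \<Longrightarrow> c > 0 \<Longrightarrow> gamble_scale (tuples X N) c f \<in> R"
    and add: "\<And>f g. f \<in> R \<Longrightarrow> g \<in> R \<Longrightarrow> gamble_add (tuples X N) f g \<in> R"
    using assms(2) by (auto simp: coherent_set_def)
  have "gamble_zero (tuples X N) \<in> gambles (tuples X N)"
    by (simp add: gambles_finite finite_tuples assms(1) gamble_zero_def)
  \<comment> \<open>If zero were the image of a member of \<open>R\<close>, the zero gamble on
    tuples, having the same image, would lie in \<open>R\<close>.\<close>
  then have "gamble_zero (count_vectors X N) \<notin> Hy X N ` R"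
    using exchangeable_cong_Hy[OF assms(1) R(1) assms(3)] R(2) Hy_zero[of X N] by force
  \<comment> \<open>A positive \<open>g\<close> lifts to the positive gamble
    \<open>Co X N g\<close>, which lies in \<open>R\<close> and is mapped back to
    \<open>g\<close>.\<close>
  moreover have "g \<in> Hy X N ` R" if "g \<in> gambles (count_vectors X N)"
    "gamble_gt (count_vectors X N) g (gamble_zero (count_vectors X N))" for g
    using pos[OF Co_in_gambles[OF assms(1)] Co_gt_zero[OF assms(1) that]] Hy_Co[OF assms(1) that(1)]
    by (metis imageI)
  moreover have "Hy X N ` R \<subseteq> gambles (count_vectors X N)"
    using Hy_in_gambles[OF assms(1)] by blast
  ultimately show ?thesis
    using scale add
    by (auto simp: coherent_set_def Hy_scale[symmetric] Hy_add[symmetric])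
qed

lemma Hy_preimage_Hy_image:
  assumes "finite X" "R \<subseteq> gambles (tuples X N)" "exchangeable X N R"
  shows "Hy_preimage X N (Hy X N ` R) = R"
  using assms(2) exchangeable_cong_Hy[OF assms] by (auto simp: Hy_preimage_def)

text \<open>The axioms pull back by linearity of \<open>Hy\<close>; the one on positive gambles uses
  strict monotonicity.\<close>

lemma coherent_set_Hy_preimage:
  assumes "finite X" "coherent_set (count_vectors X N) S"
  shows "coherent_set (tuples X N) (Hy_preimage X N S)"
  using assms Hy_gt_zero[OF assms(1)] Hy_in_gambles[OF assms(1)]
  unfolding coherent_set_def Hy_preimage_def
  by (auto simp: Hy_zero Hy_scale Hy_add finite_tuples gamble_add_in_gambles gamble_scale_in_gambles)

lemma exchangeable_Hy_preimage:
  assumes "finite X"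
  shows "exchangeable X N (Hy_preimage X N S)"
  using assms by (auto simp: exchangeable_def Hy_preimage_def Hy_add_diff_perm_gamble
      finite_tuples gamble_add_in_gambles simp del: One_nat_def)

text \<open>Since \<open>Hy\<close> undoes \<open>Co\<close>, testing \<open>Co X N g\<close>
  against the preimage amounts to testing \<open>g\<close> against \<open>S\<close>.\<close>

lemma eq_Co_vimage_Hy_preimage:
  assumes "finite X" "S \<subseteq> gambles (count_vectors X N)"
  shows "S = {g \<in> gambles (count_vectors X N). Co X N g \<in> Hy_preimage X N S}"
  using assms by (auto simp: Hy_preimage_def Hy_Co Co_in_gambles)

lemma Hy_image_Hy_preimage:
  assumes "finite X" "S \<subseteq> gambles (count_vectors X N)"
  shows "Hy X N ` Hy_preimage X N S = S"
proof
  show "S \<subseteq> Hy X N ` Hy_preimage X N S"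
    using assms Hy_Co[OF assms(1)] Co_in_gambles[OF assms(1)]
    by (fastforce simp: Hy_preimage_def intro: image_eqI[OF sym])
qed (auto simp: Hy_preimage_def)

theorem theorem17:
  fixes X :: "'a set" and N :: nat and R :: "((nat \<Rightarrow> 'a) \<Rightarrow> real) set"
  assumes "finite X" and "X \<noteq> {}" and "N \<ge> 1"
    and "R \<subseteq> gambles (tuples X N)"
  shows "((coherent_set (tuples X N) R \<and> exchangeable X N R) \<longleftrightarrow>
            (\<exists>S. coherent_set (count_vectors X N) S \<and> R = Hy_preimage X N S)) \<and>
         (coherent_set (tuples X N) R \<and> exchangeable X N R \<longrightarrow>
            (\<exists>!S. coherent_set (count_vectors X N) S \<and> R = Hy_preimage X N S)) \<and>
         (\<forall>S. coherent_set (count_vectors X N) S \<and> R = Hy_preimage X N S \<longrightarrow>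
            S = {g \<in> gambles (count_vectors X N). Co X N g \<in> R} \<and>
            S = Hy X N ` R)"
proof -
  let ?CE = "coherent_set (tuples X N) R \<and> exchangeable X N R"
  let ?P = "\<lambda>S. coherent_set (count_vectors X N) S \<and> R = Hy_preimage X N S"
  have forward: "?P (Hy X N ` R)" if ?CE
    using that assms(1,4) by (simp add: coherent_set_Hy_image Hy_preimage_Hy_image)
  have backward: ?CE if "?P S" for S
    using that coherent_set_Hy_preimage[OF assms(1)] exchangeable_Hy_preimage[OF assms(1)] by simp
  have determined: "S = {g \<in> gambles (count_vectors X N). Co X N g \<in> R} \<and> S = Hy X N ` R"
    if "?P S" for S
  proof -
    have "S \<subseteq> gambles (count_vectors X N)"
      using that by (simp add: coherent_set_def)
    then show ?thesis
      unfolding conjunct2[OF that]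
      by (intro conjI eq_Co_vimage_Hy_preimage[OF assms(1)]
          Hy_image_Hy_preimage[OF assms(1), symmetric])
  qed
  show ?thesis
  proof (intro conjI)
    show "?CE \<longleftrightarrow> (\<exists>S. ?P S)"
      by (intro iffI, rule exI, erule forward, erule exE, erule backward)
    show "?CE \<longrightarrow> (\<exists>!S. ?P S)"
      \<comment> \<open>Uniqueness comes from \<open>determined\<close>: every admissible
        \<open>S\<close> equals the image of \<open>R\<close> under \<open>Hy\<close>.\<close>
      by (intro impI ex1I[of ?P "Hy X N ` R"], erule forward, drule determined, erule conjunct2)
    show "\<forall>S. ?P S \<longrightarrow>
        S = {g \<in> gambles (count_vectors X N). Co X N g \<in> R} \<and> S = Hy X N ` R"
      using determined by (intro allI impI)
  qed
qed

end
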